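(* Let $T$ be a rooted tree of order $n$. Then $$\mu(T)< \frac{4}{7}\,n\,\rho(T).$$
   Context: A rooted tree $T$ is a finite tree with a distinguished vertex $r$, its root; its order $n$ is its number of vertices. The bottleneck matrix of $T$ is the matrix $M=[m_{ij}]$ indexed by $V(T)$, where $m_{ij}$ is the number of vertices lying both on the path joining $i$ to $r$ and on the path joining $j$ to $r$ (paths include their endpoints). The Perron value $\rho(T)$ is the spectral radius (largest eigenvalue) of $M$. The moment of $T$ is $\mu(T)=\sum_{v\in V(T)}\operatorname{dist}(v,r)\deg(v)$, where $\operatorname{dist}(v,r)$ is the number of edges in the path joining $v$ to $r$ and $\deg(v)$ is the degree of $v$ in $T$. *)

theory Defs
  imports
    "Graph_Theory.Graph_Theory"
    "Jordan_Normal_Form.Spectral_Radius"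
begin

text \<open>
  A \<^locale>\<open>pair_graph\<close> is a finite simple graph, with each edge \<open>uv\<close> stored as the two arcs
  \<open>(u,v)\<close> and \<open>(v,u)\<close>. The constant \<^const>\<open>tree\<close> of the graph library cannot be used: its
  acyclicity condition concerns directed cycles and so excludes every edge \<open>u, v, u\<close> of a symmetric
  digraph. In a simple graph these walks are exactly the instances of \<^const>\<open>pre_digraph.cycle\<close> of
  length less than 3; the longer ones are the undirected cycles.
\<close>

definition rooted_tree :: "'a pair_pre_digraph \<Rightarrow> 'a \<Rightarrow> bool" where
  "rooted_tree G r \<longleftrightarrow>
     pair_graph G \<and> r \<in> pverts G \<and>
     Digraph_Component.connected (with_proj G) \<and>
     \<not> (\<exists>c. pre_digraph.cycle (with_proj G) c \<and> length c \<ge> 3)"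

text \<open>Paths are given by their list of vertices. Each vertex of a rooted tree has exactly one path to the
  root, so the description in \<open>root_path\<close> below is proper.\<close>

lemma (in pair_graph) acyclic_vpath_unique:
  assumes acyclic: "\<not> (\<exists>c. cycle c \<and> length c \<ge> 3)"
    and "vpath p (with_proj G)" "vpath q (with_proj G)" "hd p = hd q" "last p = last q"
  shows "p = q"
  using assms(2-)
proof (induction p arbitrary: q)
  case Nil
  then show ?case by (auto simp: vpath_def vwalk_def)
next
  case (Cons u p')
  from Cons.prems obtain q' where q: "q = u # q'"
    by (cases q) (auto simp: vpath_def vwalk_def)
  have dist: "distinct (u # p')" "distinct (u # q')"
    using Cons.prems q by (auto simp: vpath_def)
  have sub: "set (vwalk_arcs (u # p')) \<subseteq> parcs G" "set (vwalk_arcs (u # q')) \<subseteq> parcs G"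
    and uV: "u \<in> pverts G"
    using Cons.prems q by (auto simp: vpath_def vwalk_def)
  have last_eq: "last (u # p') = last (u # q')" using Cons.prems q by simp
  have sym: "(b, a) \<in> parcs G" if "(a, b) \<in> parcs G" for a b
    using that pair_sym_arcs by (auto simp: symmetric_def elim: symE)
  show ?case
  proof (cases "p' = [] \<or> q' = []")
    case True
    then show ?thesis using last_eq dist q by (auto split: if_splits)
  next
    case False
    then have ne: "p' \<noteq> []" "q' \<noteq> []" by auto
    have tails: "vpath p' (with_proj G)" "vpath q' (with_proj G)"
      using Cons.prems q ne by (auto simp: vpath_def vwalk_def)
    show ?thesis
    proof (cases "hd p' = hd q'")
      case True
      then show ?thesis using Cons.IH[OF tails(1) tails(2)] last_eq ne q by simp
    next
      case False
      have common: "\<exists>x\<in>set p'. x \<in> set q'"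
        using last_eq ne by (metis last_ConsR last_in_set)
      obtain p1 x p2 where p': "p' = p1 @ x # p2" "x \<in> set q'" "\<forall>y\<in>set p1. y \<notin> set q'"
        using split_list_first_prop[OF common] by auto
      then obtain q1 q2 where q': "q' = q1 @ x # q2" by (meson split_list)
      define w where "w = p1 @ x # rev q1 @ [u]"
      have arcs1: "set (vwalk_arcs (u # p1 @ [x])) \<subseteq> parcs G"
        using sub(1) set_vwalk_arcs_append1[of "u # p1 @ [x]" p2] p' by auto
      have arcs2: "set (vwalk_arcs (u # q1 @ [x])) \<subseteq> parcs G"
        using sub(2) set_vwalk_arcs_append1[of "u # q1 @ [x]" q2] q' by auto
      have "set (vwalk_arcs (rev (u # q1 @ [x]))) \<subseteq> parcs G"
        unfolding set_vwalk_arcs_rev using arcs2 sym by auto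
      then have arcs3: "set (vwalk_arcs (x # rev q1 @ [u])) \<subseteq> parcs G" by simp
      have split: "vwalk_arcs (ys @ x # zs) = vwalk_arcs (ys @ [x]) @ vwalk_arcs (x # zs)" for ys zs
        by (induction ys rule: vwalk_arcs.induct) auto
      have "set (vwalk_arcs (u # w)) \<subseteq> parcs G"
        using arcs1 arcs3 split[of "u # p1" "rev q1 @ [u]"] unfolding w_def by auto
      moreover have "pcas y (vwalk_arcs (y # zs)) (last (y # zs))"
        and verts: "pawalk_verts y (vwalk_arcs (y # zs)) = y # zs" for y zs
        by (induction zs arbitrary: y) auto
      moreover have "last (u # w) = u" by (simp add: w_def)
      ultimately have "awalk u (vwalk_arcs (u # w)) u"
        using uV unfolding awalk_def by metis
      moreover have "distinct w" using dist p' q' by (auto simp: w_def)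
      moreover have "w \<noteq> []" by (simp add: w_def)
      ultimately have "cycle (vwalk_arcs (u # w))"
        unfolding cycle_def using verts[of u w] by auto
      moreover have "length (vwalk_arcs (u # w)) \<ge> 3"
      proof -
        have "p1 \<noteq> [] \<or> q1 \<noteq> []" using False p' q' by auto
        then have "length w \<ge> 3" by (auto simp: w_def neq_Nil_conv)
        then show ?thesis using vwalk_length_simp[of "u # w"] unfolding vwalk_length_def by simp
      qed
      ultimately show ?thesis using acyclic by blast
    qed
  qed
qed

lemma root_path_ex1:
  assumes "rooted_tree G r" "v \<in> pverts G"
  shows "\<exists>!p. vpath p (with_proj G) \<and> hd p = v \<and> last p = r"
proof -
  interpret pair_graph G using assms by (simp add: rooted_tree_def)
  have "v \<rightarrow>\<^sup>*\<^bsub>with_proj (mk_symmetric (with_proj G))\<^esub> r"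
    using assms by (auto simp: rooted_tree_def Digraph_Component.connected_def strongly_connected_def)
  then have "v \<rightarrow>\<^sup>*\<^bsub>with_proj G\<^esub> r"
    using reachable_mk_symmetric_eq pair_sym_arcs by blast
  then show ?thesis
    using reachable_vpath_conv acyclic_vpath_unique assms(1) unfolding rooted_tree_def by metis
qed

definition root_path :: "'a pair_pre_digraph \<Rightarrow> 'a \<Rightarrow> 'a \<Rightarrow> 'a list" where
  "root_path G r v = (THE p. vpath p (with_proj G) \<and> hd p = v \<and> last p = r)"

definition root_dist :: "'a pair_pre_digraph \<Rightarrow> 'a \<Rightarrow> 'a \<Rightarrow> nat" where
  "root_dist G r v = vwalk_length (root_path G r v)"

text \<open>In a symmetric digraph the out-degree is the degree of the underlying undirected graph.\<close>

definition moment :: "'a pair_pre_digraph \<Rightarrow> 'a \<Rightarrow> nat" where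
  "moment G r = (\<Sum>v\<in>pverts G. root_dist G r v * out_degree (with_proj G) v)"

definition bottleneck_entry :: "'a pair_pre_digraph \<Rightarrow> 'a \<Rightarrow> 'a \<Rightarrow> 'a \<Rightarrow> nat" where
  "bottleneck_entry G r i j = card (set (root_path G r i) \<inter> set (root_path G r j))"

text \<open>
  Matrices are indexed by natural numbers, so rows and columns are labelled through an enumeration
  \<open>vs\<close> of the vertices. The spectrum does not depend on it, see \<open>perron_value_eq\<close> below. The entries
  are complex because \<^const>\<open>spectral_radius\<close> is defined for complex matrices.
\<close>

definition bottleneck_mat :: "'a pair_pre_digraph \<Rightarrow> 'a \<Rightarrow> 'a list \<Rightarrow> complex mat" where
  "bottleneck_mat G r vs =
     mat (length vs) (length vs) (\<lambda>(i, j). of_nat (bottleneck_entry G r (vs ! i) (vs ! j)))"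

definition perron_value :: "'a pair_pre_digraph \<Rightarrow> 'a \<Rightarrow> real" where
  "perron_value G r =
     spectral_radius (bottleneck_mat G r (SOME vs. distinct vs \<and> set vs = pverts G))"

lemma eigenvalue_mat_enum:
  fixes f :: "'a \<Rightarrow> 'a \<Rightarrow> 'b :: field"
  assumes "distinct vs"
  shows "eigenvalue (mat (length vs) (length vs) (\<lambda>(i, j). f (vs ! i) (vs ! j))) k \<longleftrightarrow>
    (\<exists>x. (\<exists>v\<in>set vs. x v \<noteq> 0) \<and> (\<forall>u\<in>set vs. (\<Sum>v\<in>set vs. f u v * x v) = k * x u))"
    (is "eigenvalue ?M k \<longleftrightarrow> ?R")
proof -
  have bij: "bij_betw ((!) vs) {0..<length vs} (set vs)"
    using assms bij_betw_nth[of vs] by (auto simp: atLeast0LessThan)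
  have sum_enum: "(\<Sum>v\<in>set vs. g v) = (\<Sum>j = 0..<length vs. g (vs ! j))" for g :: "'a \<Rightarrow> 'b"
    using sum.reindex_bij_betw[OF bij, of g] by simp
  show ?thesis
  proof
    assume "eigenvalue ?M k"
    then obtain w where w: "w \<in> carrier_vec (length vs)" "w \<noteq> 0\<^sub>v (length vs)"
      and eq: "?M *\<^sub>v w = k \<cdot>\<^sub>v w"
      by (auto simp: eigenvalue_def eigenvector_def)
    obtain ix where ix: "\<And>i. i < length vs \<Longrightarrow> ix (vs ! i) = i"
      using bij_betw_inv_into_left[OF bij] by (metis atLeast0LessThan lessThan_iff)
    have "(\<Sum>j = 0..<length vs. f (vs ! i) (vs ! j) * w $ j) = k * w $ i" if "i < length vs" for i
      using arg_cong[OF eq, of "\<lambda>v. v $ i"] that w(1) by (simp add: scalar_prod_def)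
    moreover have "\<exists>i<length vs. w $ i \<noteq> 0"
      using w by (metis carrier_vecD eq_vecI index_zero_vec)
    ultimately have "(\<exists>v\<in>set vs. w $ ix v \<noteq> 0) \<and>
        (\<forall>u\<in>set vs. (\<Sum>v\<in>set vs. f u v * w $ ix v) = k * w $ ix u)"
      by (simp add: sum_enum all_set_conv_all_nth ix) (metis ix nth_mem)
    then show ?R
      by (rule exI[of _ "\<lambda>v. w $ ix v"])
  next
    assume ?R
    then obtain x where nz: "\<exists>v\<in>set vs. x v \<noteq> 0"
      and eq: "\<forall>u\<in>set vs. (\<Sum>v\<in>set vs. f u v * x v) = k * x u" by blast
    let ?w = "vec (length vs) (\<lambda>i. x (vs ! i))"
    have "?M *\<^sub>v ?w = k \<cdot>\<^sub>v ?w"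
      using eq by (intro eq_vecI) (auto simp: scalar_prod_def sum_enum)
    moreover have "?w \<noteq> 0\<^sub>v (length vs)"
      using nz by (metis in_set_conv_nth index_vec index_zero_vec(1))
    ultimately have "eigenvector ?M ?w k"
      by (simp add: eigenvector_def)
    then show "eigenvalue ?M k"
      unfolding eigenvalue_def by blast
  qed
qed

lemma perron_value_eq:
  assumes "distinct vs" "set vs = pverts G"
  shows "perron_value G r = spectral_radius (bottleneck_mat G r vs)"
proof -
  define us where "us = (SOME vs. distinct vs \<and> set vs = pverts G)"
  have us: "distinct us \<and> set us = pverts G"
    unfolding us_def using assms by (intro someI) blast
  have "spectrum (bottleneck_mat G r us) = spectrum (bottleneck_mat G r vs)"
    unfolding spectrum_def
  proof (rule Collect_cong)
    fix k
    show "eigenvalue (bottleneck_mat G r us) k \<longleftrightarrow> eigenvalue (bottleneck_mat G r vs) k"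
      using us assms
        eigenvalue_mat_enum[of us "\<lambda>u v. of_nat (bottleneck_entry G r u v)" k]
        eigenvalue_mat_enum[of vs "\<lambda>u v. of_nat (bottleneck_entry G r u v)" k]
      by (simp add: bottleneck_mat_def)
  qed
  then show ?thesis
    by (simp add: perron_value_def us_def[symmetric] spectral_radius_def)
qed

end

theory Submission
  imports Defs "HOL-Analysis.Convex"
begin

text \<open>
  Let \<open>P\<^sub>v\<close> be the vertex set of the path from \<open>v\<close> to the root, \<open>M\<close> the bottleneck matrix, with entries
  \<open>|P\<^sub>i \<inter> P\<^sub>j|\<close>, and \<open>s\<^sub>v\<close> the number of vertices \<open>i\<close> with \<open>v \<in> P\<^sub>i\<close>, that is, the size of the subtree
  consisting of \<open>v\<close> and its descendants. Both sides of the inequality are controlled by the numbers \<open>s\<^sub>v\<close>.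

  Since \<open>M\<close> is symmetric, its Rayleigh quotient at the all-ones vector is at most the spectral radius:
  \<open>n \<rho>\<close> is at least the sum of all entries of \<open>M\<close> (\<open>sum_mat_le_spectral_radius\<close>), and counting the
  common vertices one by one turns this sum into \<open>\<Sum>\<^sub>v s\<^sub>v\<^sup>2\<close> (\<open>sum_card_Int_eq_sum_squares\<close>).

  Charging each edge to its end \<open>v\<close> farther from the root gives the moment a contribution of
  \<open>2 dist(v,r) - 1 = 2 |P\<^sub>v| - 3\<close> for each \<open>v \<noteq> r\<close> (\<open>moment_le\<close>). The missing term for \<open>r\<close> would be
  \<open>-1\<close> and \<open>\<Sum>\<^sub>v |P\<^sub>v| = \<Sum>\<^sub>v s\<^sub>v\<close>, so \<open>\<mu> \<le> \<Sum>\<^sub>v (2 s\<^sub>v - 3) + 1\<close>.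

  It remains to compare the two sums term by term: \<open>4/7 (s - 7/4)\<^sup>2 \<ge> 0\<close> says that
  \<open>2 s - 7/4 \<le> 4/7 s\<^sup>2\<close>, hence \<open>2 s - 3\<close> is smaller than \<open>4/7 s\<^sup>2\<close> by at least \<open>5/4\<close>. The \<open>n \<ge> 1\<close>
  vertices together save at least \<open>5/4\<close>, which pays for the final \<open>+ 1\<close> and makes the inequality strict.
\<close>

section \<open>Averages of symmetric matrices\<close>

lemma pow_mat_add:
  fixes A :: "'a :: semiring_1 mat"
  assumes "A \<in> carrier_mat n n"
  shows "A ^\<^sub>m (k + l) = A ^\<^sub>m k * A ^\<^sub>m l"
proof -
  interpret semiring "ring_mat TYPE('a) n ()" by (rule semiring_mat)
  show ?thesis
    using nat_pow_mult[of A k l] assms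
    by (simp add: pow_mat_ring_pow[OF assms, of _ "()"] ring_mat_def)
qed

lemma transpose_pow_symmetric:
  fixes A :: "'a :: comm_semiring_1 mat"
  assumes "A \<in> carrier_mat n n" "transpose_mat A = A"
  shows "transpose_mat (A ^\<^sub>m k) = A ^\<^sub>m k"
proof (induction k)
  case 0
  show ?case by simp
next
  case (Suc k)
  have "transpose_mat (A ^\<^sub>m Suc k) = A * A ^\<^sub>m k"
    using Suc assms by (simp add: transpose_mult[of _ n n _ n])
  then show ?case
    using pow_mat_add[OF assms(1), of 1 k] assms(1) by simp
qed

text \<open>
  For the all-ones vector \<open>e\<close>, symmetry gives \<open>e\<^sup>T S\<^sup>2 e = |S e|\<^sup>2\<close>, and \<open>e\<^sup>T S e\<close> is the inner product
  of \<open>e\<close> with \<open>S e\<close>; so this is the Cauchy-Schwarz inequality.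
\<close>
lemma sum_mat_square_symmetric:
  fixes S :: "real mat"
  assumes S: "S \<in> carrier_mat n n" and sym: "transpose_mat S = S"
  shows "(sum_mat S)\<^sup>2 \<le> real n * sum_mat (S * S)"
proof -
  have swap: "S $$ (i, j) = S $$ (j, i)" if "i < n" "j < n" for i j
    using arg_cong[OF sym, of "\<lambda>M. M $$ (j, i)"] S that by simp
  have "sum_mat (S * S) = (\<Sum>i = 0..<n. \<Sum>j = 0..<n. \<Sum>k = 0..<n. S $$ (i, k) * S $$ (k, j))"
    using S by (simp add: sum_mat_def sum.cartesian_product' scalar_prod_def)
  also have "\<dots> = (\<Sum>i = 0..<n. \<Sum>k = 0..<n. \<Sum>j = 0..<n. S $$ (i, k) * S $$ (k, j))"
    by (intro sum.cong refl sum.swap)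
  also have "\<dots> = (\<Sum>k = 0..<n. \<Sum>i = 0..<n. \<Sum>j = 0..<n. S $$ (i, k) * S $$ (k, j))"
    by (rule sum.swap)
  also have "\<dots> = (\<Sum>k = 0..<n. (\<Sum>j = 0..<n. S $$ (k, j))\<^sup>2)"
    unfolding power2_eq_square sum_product
    by (intro sum.cong refl) (simp add: swap)
  finally have "sum_mat (S * S) = (\<Sum>k = 0..<n. (\<Sum>j = 0..<n. S $$ (k, j))\<^sup>2)" .
  moreover have "sum_mat S = (\<Sum>k = 0..<n. \<Sum>j = 0..<n. S $$ (k, j))"
    using S by (simp add: sum_mat_def sum.cartesian_product')
  ultimately show ?thesis
    using sum_squared_le_sum_of_squares[of "\<lambda>k. \<Sum>j = 0..<n. S $$ (k, j)" "{0..<n}"]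
    by (simp add: mult.commute)
qed

text \<open>
  Repeated squaring: if the average row sum of a power of \<open>S\<close> is at least \<open>x \<ge> 0\<close>, that of its square is
  at least \<open>x\<^sup>2\<close> by \<open>sum_mat_square_symmetric\<close>.
\<close>
lemma sum_mat_pow_ge:
  fixes S :: "real mat"
  assumes S: "S \<in> carrier_mat n n" and sym: "transpose_mat S = S"
    and n: "n > 0" and c: "c \<ge> 0" and le: "real n * c \<le> sum_mat S"
  shows "real n * c ^ 2 ^ j \<le> sum_mat (S ^\<^sub>m (2 ^ j))"
proof (induction j)
  case 0
  then show ?case using le S by simp
next
  case (Suc j)
  let ?P = "S ^\<^sub>m (2 ^ j)"
  have "(real n * c ^ 2 ^ j)\<^sup>2 \<le> (sum_mat ?P)\<^sup>2"
    using Suc c by (intro power_mono) auto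
  also have "\<dots> \<le> real n * sum_mat (?P * ?P)"
    using sum_mat_square_symmetric[OF pow_carrier_mat[OF S]] transpose_pow_symmetric[OF S sym] by blast
  also have "?P * ?P = S ^\<^sub>m (2 ^ Suc j)"
    using pow_mat_add[OF S, of "2 ^ j" "2 ^ j"] by (simp add: mult_2)
  also have "(real n * c ^ 2 ^ j)\<^sup>2 = real n * (real n * c ^ 2 ^ Suc j)"
    by (simp add: power2_eq_square mult_2 power_add)
  finally show ?case using n by simp
qed

text \<open>
  If the spectral radius were below 1, the powers of \<open>S\<close> would have bounded entries, which
  contradicts their geometric growth. Arguing with powers replaces the diagonalisation of \<open>S\<close>.
\<close>
lemma spectral_radius_ge_1:
  fixes S :: "real mat"
  assumes S: "S \<in> carrier_mat n n" and sym: "transpose_mat S = S"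
    and gt: "real n < sum_mat S"
  shows "1 \<le> spectral_radius (map_mat complex_of_real S)"
proof (rule ccontr)
  let ?A = "map_mat complex_of_real S"
  assume "\<not> ?thesis"
  then have "spectral_radius ?A < 1" by simp
  moreover have A: "?A \<in> carrier_mat n n" using S by simp
  ultimately obtain b where b: "\<And>k. norm_bound (?A ^\<^sub>m k) b"
    using spectral_radius_jnf_norm_bound_less_1_upper_triangular by blast
  have n: "n > 0"
    using gt S by (cases n) (auto simp: sum_mat_def)
  define c where "c = sum_mat S / n"
  have c: "c > 1" using gt n by (simp add: c_def)
  have "real n * c ^ 2 ^ j \<le> real n * (real n * b)" for j
  proof -
    let ?P = "S ^\<^sub>m (2 ^ j)"
    have entry: "?P $$ (i, k) \<le> b" if "i < n" "k < n" for i k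
    proof -
      have "?A ^\<^sub>m (2 ^ j) = map_mat complex_of_real ?P"
        using of_real_hom.mat_hom_pow[OF S] by metis
      then have "norm (complex_of_real (?P $$ (i, k))) \<le> b"
        using b[of "2 ^ j"] S that by (simp add: norm_bound_def)
      then show ?thesis by simp
    qed
    have "real n * c ^ 2 ^ j \<le> sum_mat ?P"
      using sum_mat_pow_ge[OF S sym n, of c] c n by (simp add: c_def)
    also have "\<dots> = (\<Sum>ij \<in> {0..<n} \<times> {0..<n}. ?P $$ ij)"
      using S by (simp add: sum_mat_def)
    also have "\<dots> \<le> (\<Sum>ij \<in> {0..<n} \<times> {0..<n}. b)"
      using entry by (intro sum_mono) auto
    finally show ?thesis by simp
  qed
  then have bounded: "c ^ 2 ^ j \<le> real n * b" for j using n by simp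
  obtain m where "real n * b < c ^ m"
    using real_arch_pow[OF c] by blast
  also have "c ^ m \<le> c ^ 2 ^ m"
    using c by (intro power_increasing) (auto intro: less_imp_le)
  finally show False using bounded[of m] by simp
qed

lemma spectral_radius_smult_ge:
  assumes A: "A \<in> carrier_mat n n" and n: "n > 0" and t: "t > 0"
  shows "spectral_radius (complex_of_real (1 / t) \<cdot>\<^sub>m A) \<le> spectral_radius A / t"
proof -
  let ?B = "complex_of_real (1 / t) \<cdot>\<^sub>m A"
  have B: "?B \<in> carrier_mat n n" using A by simp
  obtain k where k: "eigenvalue ?B k" "spectral_radius ?B = norm k"
    using spectral_radius_mem_max(1)[OF B n] by (auto simp: spectrum_def)
  then obtain v where v: "v \<in> carrier_vec n" "v \<noteq> 0\<^sub>v n" "?B *\<^sub>v v = k \<cdot>\<^sub>v v"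
    using A by (auto simp: eigenvalue_def eigenvector_def)
  have "complex_of_real t \<cdot>\<^sub>v (?B *\<^sub>v v) = A *\<^sub>v v"
    using A v(1) t by (intro eq_vecI) (auto simp: scalar_prod_def sum_distrib_left)
  then have "A *\<^sub>v v = (of_real t * k) \<cdot>\<^sub>v v"
    using v by (simp add: smult_smult_assoc)
  then have "eigenvalue A (of_real t * k)"
    using A v unfolding eigenvalue_def eigenvector_def by auto
  then have "norm (of_real t * k) \<le> spectral_radius A"
    using spectral_radius_mem_max(2)[OF A n] by (auto simp: spectrum_def)
  then show ?thesis using k t by (simp add: norm_mult field_simps)
qed

text \<open>
  The Rayleigh bound at the all-ones vector, by rescaling: a number \<open>t\<close> strictly between the spectral
  radius and the average row sum would make \<open>S / t\<close> a counterexample to \<open>spectral_radius_ge_1\<close>.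
\<close>
theorem sum_mat_le_spectral_radius:
  fixes S :: "real mat"
  assumes S: "S \<in> carrier_mat n n" and sym: "transpose_mat S = S" and n: "n > 0"
  shows "sum_mat S \<le> real n * spectral_radius (map_mat complex_of_real S)"
proof (rule ccontr)
  let ?A = "map_mat complex_of_real S"
  have A: "?A \<in> carrier_mat n n" using S by simp
  assume "\<not> ?thesis"
  then have "spectral_radius ?A < sum_mat S / n"
    using n by (simp add: field_simps)
  then obtain t where t: "spectral_radius ?A < t" "t < sum_mat S / n"
    using dense by blast
  have "spectral_radius ?A \<ge> 0"
    using spectral_radius_mem_max(1)[OF A n] by auto
  then have t0: "t > 0" using t by simp
  define R where "R = (1 / t) \<cdot>\<^sub>m S"
  have R: "R \<in> carrier_mat n n" using S by (simp add: R_def)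
  have "transpose_mat R = R"
  proof (rule eq_matI)
    fix i j assume "i < dim_row R" "j < dim_col R"
    then show "transpose_mat R $$ (i, j) = R $$ (i, j)"
      using arg_cong[OF sym, of "\<lambda>M. M $$ (i, j)"] S by (simp add: R_def)
  qed (use S in \<open>auto simp: R_def\<close>)
  moreover have "sum_mat R = sum_mat S / t"
    using S unfolding R_def sum_mat_def sum_divide_distrib by (intro sum.cong) auto
  moreover have "real n < sum_mat S / t"
    using t(2) t0 n by (simp add: field_simps)
  ultimately have "1 \<le> spectral_radius (map_mat complex_of_real R)"
    using spectral_radius_ge_1[OF R] by simp
  also have "map_mat complex_of_real R = complex_of_real (1 / t) \<cdot>\<^sub>m ?A"
    using S by (intro eq_matI) (auto simp: R_def)
  also have "spectral_radius \<dots> \<le> spectral_radius ?A / t"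
    by (rule spectral_radius_smult_ge[OF A n t0])
  also have "\<dots> < 1" using t t0 by simp
  finally show False by simp
qed

section \<open>Double counting over the root paths\<close>

text \<open>
  Both sides count the triples \<open>(i, j, v)\<close> with \<open>v \<in> P i \<inter> P j\<close>.
\<close>
lemma sum_card_Int_eq_sum_squares:
  assumes "finite V" and "\<And>i. i \<in> V \<Longrightarrow> P i \<subseteq> V"
  shows "(\<Sum>i\<in>V. \<Sum>j\<in>V. card (P i \<inter> P j)) = (\<Sum>v\<in>V. (card {i\<in>V. v \<in> P i})\<^sup>2)"
proof -
  have "card (P i \<inter> P j) = (\<Sum>v\<in>V. of_bool (v \<in> P i) * of_bool (v \<in> P j))"
    if "i \<in> V" "j \<in> V" for i j
  proof -
    have "P i \<inter> P j = V \<inter> {v. v \<in> P i \<and> v \<in> P j}" using assms(2) that by blast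
    then show ?thesis using assms(1) by (simp flip: of_bool_conj)
  qed
  then have "(\<Sum>i\<in>V. \<Sum>j\<in>V. card (P i \<inter> P j)) =
      (\<Sum>i\<in>V. \<Sum>j\<in>V. \<Sum>v\<in>V. of_bool (v \<in> P i) * of_bool (v \<in> P j))"
    by simp
  also have "\<dots> = (\<Sum>i\<in>V. \<Sum>v\<in>V. \<Sum>j\<in>V. of_bool (v \<in> P i) * of_bool (v \<in> P j))"
    by (intro sum.cong refl sum.swap)
  also have "\<dots> = (\<Sum>v\<in>V. \<Sum>i\<in>V. \<Sum>j\<in>V. of_bool (v \<in> P i) * of_bool (v \<in> P j))"
    by (rule sum.swap)
  also have "\<dots> = (\<Sum>v\<in>V. (card {i\<in>V. v \<in> P i})\<^sup>2)"
  proof (rule sum.cong[OF refl])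
    fix v
    have card_eq: "card {i\<in>V. v \<in> P i} = (\<Sum>i\<in>V. of_bool (v \<in> P i))"
      using assms(1) by (simp add: Collect_conj_eq)
    show "(\<Sum>i\<in>V. \<Sum>j\<in>V. of_bool (v \<in> P i) * of_bool (v \<in> P j)) = (card {i\<in>V. v \<in> P i})\<^sup>2"
      unfolding card_eq power2_eq_square sum_product by (rule refl)
  qed
  finally show ?thesis .
qed

text \<open>
  With \<open>s v\<close> the number of sets \<open>P i\<close> containing \<open>v\<close>, the left side is \<open>\<Sum>\<^sub>v (2 s v - 7/4)\<close> and the
  right side is \<open>\<Sum>\<^sub>v 4/7 (s v)\<^sup>2\<close>. The constant \<open>7/4\<close> makes the difference of the summands the
  square \<open>4/7 (s v - 7/4)\<^sup>2\<close>.
\<close>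
lemma sum_card_le_sum_card_Int:
  assumes fin: "finite V" and sub: "\<And>i. i \<in> V \<Longrightarrow> P i \<subseteq> V"
  shows "(\<Sum>i\<in>V. 2 * real (card (P i)) - 7 / 4)
    \<le> 4 / 7 * real (\<Sum>i\<in>V. \<Sum>j\<in>V. card (P i \<inter> P j))"
proof -
  define s where "s v = card {i\<in>V. v \<in> P i}" for v
  have "(\<Sum>i\<in>V. card (P i)) = (\<Sum>i\<in>V. card {v\<in>V. v \<in> P i})"
    using sub by (intro sum.cong refl arg_cong[of _ _ card]) auto
  also have "\<dots> = (\<Sum>v\<in>V. s v)"
    unfolding s_def using fin by (intro sum_multicount_gen[symmetric]) auto
  finally have "(\<Sum>i\<in>V. real (card (P i))) = (\<Sum>v\<in>V. real (s v))"
    by (metis of_nat_sum)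
  then have "(\<Sum>i\<in>V. 2 * real (card (P i)) - 7 / 4) = (\<Sum>v\<in>V. 2 * real (s v) - 7 / 4)"
    by (simp add: sum_subtractf flip: sum_distrib_left)
  also have "\<dots> \<le> (\<Sum>v\<in>V. 4 / 7 * (real (s v))\<^sup>2)"
  proof (rule sum_mono)
    fix v
    have "0 \<le> 4 / 7 * (real (s v) - 7 / 4)\<^sup>2" by simp
    then show "2 * real (s v) - 7 / 4 \<le> 4 / 7 * (real (s v))\<^sup>2"
      by (simp add: power2_eq_square algebra_simps)
  qed
  also have "\<dots> = 4 / 7 * real (\<Sum>i\<in>V. \<Sum>j\<in>V. card (P i \<inter> P j))"
    by (simp add: sum_card_Int_eq_sum_squares[of V P, OF fin sub] s_def sum_distrib_left)
  finally show ?thesis .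
qed

section \<open>The moment as a sum over edges\<close>

lemma root_path:
  assumes "rooted_tree T r" "v \<in> pverts T"
  shows "vpath (root_path T r v) (with_proj T)" "hd (root_path T r v) = v"
    "last (root_path T r v) = r"
  using theI'[OF root_path_ex1[OF assms]] unfolding root_path_def by auto

lemma root_path_eqI:
  assumes "rooted_tree T r" "v \<in> pverts T"
    and "vpath p (with_proj T)" "hd p = v" "last p = r"
  shows "root_path T r v = p"
  using the1_equality[OF root_path_ex1[OF assms(1,2)]] assms(3-) unfolding root_path_def by auto

lemma root_path_nonempty:
  assumes "rooted_tree T r" "v \<in> pverts T"
  shows "root_path T r v \<noteq> []"
  using root_path(1)[OF assms] by (auto simp: vpath_def vwalk_def)

lemma root_path_subset:
  assumes "rooted_tree T r" "v \<in> pverts T"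
  shows "set (root_path T r v) \<subseteq> pverts T"
  using root_path(1)[OF assms] by (auto simp: vpath_def vwalk_def)

lemma root_path_root:
  assumes "rooted_tree T r"
  shows "root_path T r r = [r]"
  using assms by (intro root_path_eqI) (auto simp: rooted_tree_def vpath_def vwalk_def)

lemma card_root_path:
  assumes "rooted_tree T r" "v \<in> pverts T"
  shows "card (set (root_path T r v)) = Suc (root_dist T r v)"
  using root_path(1)[OF assms] root_path_nonempty[OF assms]
  by (simp add: root_dist_def vpath_def distinct_card)

lemma root_dist_pos:
  assumes "rooted_tree T r" "v \<in> pverts T" "v \<noteq> r"
  shows "root_dist T r v > 0"
  using root_path(2,3)[OF assms(1,2)] root_path_nonempty[OF assms(1,2)] assms(3)
  by (cases "root_path T r v") (auto simp: root_dist_def split: if_splits)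

lemma root_path_Cons:
  assumes T: "rooted_tree T r" and arc: "(u, v) \<in> parcs T" and notin: "u \<notin> set (root_path T r v)"
  shows "root_path T r u = u # root_path T r v"
proof -
  interpret pair_graph T using T by (simp add: rooted_tree_def)
  have V: "u \<in> pverts T" "v \<in> pverts T" using arc in_arcsD1 in_arcsD2 by auto
  note v = root_path[OF T V(2)] root_path_nonempty[OF T V(2)]
  have "vpath (u # root_path T r v) (with_proj T)"
    using v notin V arc by (auto simp: vpath_def intro!: vwalk_consI)
  then show ?thesis
    using root_path_eqI[OF T V(1)] v by simp
qed

text \<open>
  Only meaningful for \<open>v \<noteq> r\<close>: the path from \<open>r\<close> to itself has no second vertex.
\<close>
definition parent :: "'a pair_pre_digraph \<Rightarrow> 'a \<Rightarrow> 'a \<Rightarrow> 'a" where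
  "parent T r v = hd (tl (root_path T r v))"

text \<open>
  Every edge joins a vertex to its parent. If \<open>u\<close> is not on the path of \<open>v\<close>, then that path can be
  prolonged by \<open>u\<close>. If \<open>u\<close> is on it, the rest of the path from \<open>u\<close> onwards is the path of \<open>u\<close>; it avoids
  \<open>v\<close>, and the first case applies with the two ends exchanged.
\<close>
lemma arc_cases:
  assumes T: "rooted_tree T r" and arc: "(u, v) \<in> parcs T"
  obtains "u \<noteq> r" "v = parent T r u" | "v \<noteq> r" "u = parent T r v" 
    "root_dist T r v = Suc (root_dist T r u)"
proof -
  interpret pair_graph T using T by (simp add: rooted_tree_def)
  have V: "u \<in> pverts T" "v \<in> pverts T" and ne: "u \<noteq> v"
    using arc in_arcsD1 in_arcsD2 pair_no_loops[OF arc] by auto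
  have up: "x \<noteq> r \<and> y = parent T r x \<and> root_dist T r x = Suc (root_dist T r y)"
    if "x \<in> pverts T" "y \<in> pverts T" and eq: "root_path T r x = x # root_path T r y" for x y
  proof -
    note y = root_path[OF T that(2)] root_path_nonempty[OF T that(2)]
    have "x \<noteq> r" using eq y root_path_root[OF T] by auto
    then show ?thesis using eq y by (simp add: parent_def root_dist_def)
  qed
  show ?thesis
  proof (cases "u \<in> set (root_path T r v)")
    case False
    then show ?thesis using up[OF V root_path_Cons[OF T arc]] that(1) by blast
  next
    case True
    then obtain xs ys where split: "root_path T r v = xs @ u # ys" by (meson split_list)
    note v = root_path[OF T V(2)]
    have "vpath (u # ys) (with_proj T)"
      using v(1) split by (auto simp: vpath_def intro: vwalkI_append_r)
    then have u: "root_path T r u = u # ys"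
      using root_path_eqI[OF T V(1)] v split by simp
    obtain zs where "xs = v # zs" using v(2) split ne by (cases xs) auto
    then have "v \<notin> set (root_path T r u)"
      using v(1) split ne u by (auto simp: vpath_def)
    moreover have "(v, u) \<in> parcs T" using arc pair_sym_arcs by (auto simp: symmetric_def elim: symE)
    ultimately show ?thesis using up[OF V(2,1)] root_path_Cons[OF T] that(2) by blast
  qed
qed

lemma moment_eq_sum_arcs:
  assumes "pair_fin_digraph T"
  shows "moment T r = (\<Sum>(u, v)\<in>parcs T. root_dist T r u)"
proof -
  interpret pair_fin_digraph T by fact
  have "moment T r = (\<Sum>u\<in>pverts T. \<Sum>e | e \<in> parcs T \<and> fst e = u. root_dist T r (fst e))"
    by (simp add: moment_def out_degree_def out_arcs_def mult.commute)
  also have "\<dots> = (\<Sum>e\<in>parcs T. root_dist T r (fst e))"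
    by (intro sum.group) (auto simp: in_arcsD1)
  finally show ?thesis by (simp add: case_prod_unfold)
qed

text \<open>
  Regroup the sum over arcs by the end \<open>v\<close> of the edge farther from the root: its upward arc contributes the distance
  of \<open>v\<close>, its downward arc that of the parent, which is one less. The bound is in fact an equality.
\<close>
lemma moment_le:
  assumes T: "rooted_tree T r"
  shows "moment T r \<le> (\<Sum>v\<in>pverts T - {r}. 2 * root_dist T r v - 1)"
proof -
  interpret pair_graph T using T by (simp add: rooted_tree_def)
  let ?d = "root_dist T r" and ?V = "pverts T - {r}"
  define down where "down = {(u, v) \<in> parcs T. v \<noteq> r \<and> u = parent T r v \<and> ?d v = Suc (?d u)}"
  define up where "up = (\<lambda>u. (u, parent T r u)) ` ?V"
  have "down \<subseteq> parcs T" by (auto simp: down_def)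
  then have fin: "finite up" "finite down"
    using finite_subset[OF _ pair_finite_arcs] by (auto simp: up_def)
  have "parcs T \<subseteq> up \<union> down"
  proof (rule subrelI)
    fix u v assume arc: "(u, v) \<in> parcs T"
    from arc_cases[OF T arc] show "(u, v) \<in> up \<union> down"
    proof cases
      case 1
      then show ?thesis using in_arcsD1[OF arc] by (auto simp: up_def)
    next
      case 2
      then show ?thesis using arc by (simp add: down_def)
    qed
  qed
  then have "moment T r \<le> (\<Sum>e\<in>up \<union> down. ?d (fst e))"
    unfolding moment_eq_sum_arcs[OF pair_fin_digraph_axioms] case_prod_unfold
    using fin by (intro sum_mono2) auto
  also have "\<dots> \<le> (\<Sum>e\<in>up. ?d (fst e)) + (\<Sum>e\<in>down. ?d (fst e))"
    using fin sum.union_inter[of up down "\<lambda>e. ?d (fst e)"] by linarith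
  also have "(\<Sum>e\<in>up. ?d (fst e)) = (\<Sum>v\<in>?V. ?d v)"
    unfolding up_def by (subst sum.reindex) (auto simp: inj_on_def)
  also have "(\<Sum>e\<in>down. ?d (fst e)) = (\<Sum>e\<in>down. ?d (snd e) - 1)"
    by (rule sum.cong) (auto simp: down_def)
  also have "\<dots> = (\<Sum>v\<in>snd ` down. ?d v - 1)"
    by (subst sum.reindex) (auto simp: inj_on_def down_def)
  also have "\<dots> \<le> (\<Sum>v\<in>?V. ?d v - 1)"
    by (intro sum_mono2) (auto simp: down_def in_arcsD2)
  finally have "moment T r \<le> (\<Sum>v\<in>?V. ?d v + (?d v - 1))"
    by (simp add: sum.distrib)
  also have "\<dots> \<le> (\<Sum>v\<in>?V. 2 * ?d v - 1)"
    by (intro sum_mono) auto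
  finally show ?thesis .
qed

section \<open>The bound\<close>

text \<open>
  The Rayleigh bound transferred from matrices, indexed by numbers, to sums over the vertices.
\<close>
lemma sum_bottleneck_le_perron_value:
  assumes T: "rooted_tree T r"
  shows "real (\<Sum>i\<in>pverts T. \<Sum>j\<in>pverts T. bottleneck_entry T r i j)
    \<le> real (card (pverts T)) * perron_value T r"
proof -
  interpret pair_graph T using T by (simp add: rooted_tree_def)
  obtain vs where vs: "set vs = pverts T" "distinct vs"
    using finite_distinct_list[of "pverts T"] by auto
  let ?n = "length vs"
  have n: "?n = card (pverts T)" using vs distinct_card by metis
  have n0: "?n > 0" using T vs by (auto simp: rooted_tree_def)
  define S where "S = mat ?n ?n (\<lambda>(i, j). real (bottleneck_entry T r (vs ! i) (vs ! j)))"
  have S: "S \<in> carrier_mat ?n ?n" by (simp add: S_def)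
  have sym: "transpose_mat S = S"
    by (intro eq_matI) (auto simp: S_def bottleneck_entry_def Int_commute)
  have bij: "bij_betw ((!) vs) {0..<?n} (pverts T)"
    using vs bij_betw_nth[of vs] by (auto simp: atLeast0LessThan)
  have "sum_mat S = (\<Sum>i = 0..<?n. \<Sum>j = 0..<?n. real (bottleneck_entry T r (vs ! i) (vs ! j)))"
    by (simp add: sum_mat_def S_def sum.cartesian_product')
  also have "\<dots> = (\<Sum>i\<in>pverts T. \<Sum>j\<in>pverts T. real (bottleneck_entry T r i j))"
    by (simp add: sum.reindex_bij_betw[OF bij, of "\<lambda>j. real (bottleneck_entry T r _ j)"]
        sum.reindex_bij_betw[OF bij, of "\<lambda>i. \<Sum>j\<in>pverts T. real (bottleneck_entry T r i j)"])
  finally have "sum_mat S = (\<Sum>i\<in>pverts T. \<Sum>j\<in>pverts T. real (bottleneck_entry T r i j))" .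
  moreover have "map_mat complex_of_real S = bottleneck_mat T r vs"
    by (intro eq_matI) (auto simp: S_def bottleneck_mat_def)
  ultimately show ?thesis
    using sum_mat_le_spectral_radius[OF S sym n0] perron_value_eq[OF vs(2,1)] n by simp
qed

theorem theorem5p5:
  fixes T :: "'a pair_pre_digraph" and r :: 'a and n :: nat
  assumes "rooted_tree T r"
    and "n = card (pverts T)"
  shows "real (moment T r) < 4 / 7 * real n * perron_value T r"
proof -
  interpret pair_graph T using assms(1) by (simp add: rooted_tree_def)
  let ?V = "pverts T" and ?P = "\<lambda>v. set (root_path T r v)"
  have r: "r \<in> ?V" using assms(1) by (simp add: rooted_tree_def)
  then have n: "n > 0" using assms(2) by (auto simp: card_gt_0_iff)
  have dist: "real (2 * root_dist T r v - 1) = 2 * real (card (?P v)) - 3" if "v \<in> ?V - {r}" for v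
    using card_root_path[OF assms(1), of v] root_dist_pos[OF assms(1), of v] that
    by (simp add: of_nat_diff)
  have "real (moment T r) \<le> (\<Sum>v\<in>?V - {r}. 2 * real (card (?P v)) - 3)"
    using of_nat_mono[OF moment_le[OF assms(1)], where ?'a = real] dist by (simp only: of_nat_sum) simp
  also have "\<dots> = (\<Sum>v\<in>?V. 2 * real (card (?P v)) - 3) + 1"
    using r root_path_root[OF assms(1)] by (subst sum.remove[of ?V r]) auto
  also have "\<dots> = (\<Sum>v\<in>?V. 2 * real (card (?P v)) - 7 / 4) + (1 - 5 / 4 * real n)"
    by (simp add: sum_subtractf assms(2))
  also have "\<dots> < (\<Sum>v\<in>?V. 2 * real (card (?P v)) - 7 / 4)"
    using n by linarith
  also have "\<dots> \<le> 4 / 7 * real (\<Sum>i\<in>?V. \<Sum>j\<in>?V. bottleneck_entry T r i j)"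
    unfolding bottleneck_entry_def
    by (intro sum_card_le_sum_card_Int root_path_subset[OF assms(1)]) auto
  also have "\<dots> \<le> 4 / 7 * (real n * perron_value T r)"
    using sum_bottleneck_le_perron_value[OF assms(1)] assms(2) by (intro mult_left_mono) auto
  finally show ?thesis by simp
qed

end
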